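(* Let $H\in[0,+\infty)^{M\times N}$ have rows $H_m=(H_{m,n})_{1\le n\le N}$, let $y=(y_m)_{1\le m\le M}\in\mathbb{N}^M$ and $b_m\in(0,+\infty)$ for $1\le m\le M$. Assume $\sum_{n=1}^N H_{m,n}>0$ for every $m$ and that all components of $H^\top y$ are positive. Let $\zeta_m=1/\sum_{n=1}^N H_{m,n}$, $\rho=\min_{1\le m\le M}\zeta_m b_m$, and $$\ell(x)=-\sum_{m=1}^M y_m\ln(H_m x+b_m),\qquad x\in(-\rho,+\infty)^N .$$ Let $\mathcal{D}=(0,+\infty)^N$ and $z\in\mathcal{D}$. Set $$a_{1,n}(z)=\sum_{m=1}^M y_m\frac{H_{m,n}(z_n+\zeta_m b_m)}{H_m z+b_m},\qquad a_{6,n}(z)=\sum_{m=1}^M y_m\frac{H_{m,n}z_n}{H_m z+b_m}\qquad(1\le n\le N).$$ Each of the following functions $h$ (extended by $+\infty$ outside $(0,+\infty)^N$) is a Legendre function, and $x\in\mathcal{D}\mapsto\ell(z)+\langle\nabla\ell(z),x-z\rangle+D_h(x,z)$ is a Bregman tangent majorant of $\ell$ at $z$ on $\mathcal{D}$ associated with $h$: (Maj-5) $h_{5,z}(x)=-\sum_{n=1}^N a_{1,n}(z)\ln x_n$ for $x\in(0,+\infty)^N$; (Maj-6) $h_{6,z}(x)=-\sum_{n=1}^N a_{6,n}(z)\ln x_n$ for $x\in(0,+\infty)^N$. In addition, letting $h_{1,z}(x)=-\sum_{n=1}^N a_{1,n}(z)\ln(x_n+\rho)$ for $x\in(-\rho,+\infty)^N$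 (and $+\infty$ elsewhere): (i) $h_{1,z}\preceq h_{5,z}$; (ii) $h_{6,z}\preceq h_{5,z}$.
   Context: $x_n,z_n$ are the components of $x,z\in\mathbb{R}^N$; $\langle\cdot,\cdot\rangle$, $\|\cdot\|$ are Euclidean; $\Gamma_0(\mathbb{R}^N)$ is the set of proper lower semicontinuous convex functions $\mathbb{R}^N\to\mathbb{R}\cup\{+\infty\}$. Legendre functions. $h\in\Gamma_0(\mathbb{R}^N)$ is essentially smooth if it is differentiable on $\operatorname{int}(\operatorname{dom} h)$ and $\|\nabla h(y^k)\|\to+\infty$ for every sequence $(y^k)$ in $\operatorname{int}(\operatorname{dom} h)$ converging to a boundary point of $\operatorname{dom} h$; it is Legendre if it is essentially smooth and strictly convex on $\operatorname{int}(\operatorname{dom} h)$. The Bregman distance of a Legendre function $h$ is $D_h(x,y)=h(x)-h(y)-\langle\nabla h(y),x-y\rangle$ for $(x,y)\in\operatorname{dom} h\times\operatorname{int}(\operatorname{dom} h)$. Bregman tangent majorant. For a function $f$ differentiable on an open set $\mathcal{D}\subset\mathbb{R}^N$, $z\in\mathcal{D}$ and a Legendre function $h_z$, the function $Q_f(x,z)=f(z)+\langle\nabla f(z),x-z\rangle+D_{h_z}(x,z)$, $x\in\mathcal{D}$, is a Bregman tangent majorant of $f$ at $z$ associated with $h_z$ if $f(x)\le Q_f(x,z)$ for all $x\in\mathcal{D}$. Order. For Legendre functions $h_1,h_2$, $h_1\preceq h_2$ means $D_{h_1}(x,y)\le D_{h_2}(x,y)$ for all $(x,y)\in(\operatorname{dom}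 h_1\cap\operatorname{dom} h_2)\times(\operatorname{int}(\operatorname{dom} h_1)\cap\operatorname{int}(\operatorname{dom} h_2))$. *)

theory Defs
  imports "HOL-Analysis.Analysis"
begin

section \<open>Legendre functions and Bregman distances\<close>

definition edom :: "('a \<Rightarrow> ereal) \<Rightarrow> 'a set" where
  "edom h = {x. h x < \<infinity>}"

definition proper_fun :: "('a \<Rightarrow> ereal) \<Rightarrow> bool" where
  "proper_fun h \<longleftrightarrow> (\<forall>x. h x \<noteq> -\<infinity>) \<and> edom h \<noteq> {}"

definition lsc_fun :: "('a::euclidean_space \<Rightarrow> ereal) \<Rightarrow> bool" where
  "lsc_fun h \<longleftrightarrow> (\<forall>x. h x \<le> Liminf (at x) h)"

(* The products are harmless at t = 0 and t = 1, since 0 * \<infinity> = 0 in ereal; sums of the form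
   \<infinity> - \<infinity> cannot arise for a function that is proper. *)
definition convex_efun :: "('a::euclidean_space \<Rightarrow> ereal) \<Rightarrow> bool" where
  "convex_efun h \<longleftrightarrow>
     (\<forall>x y. \<forall>t\<in>{0..1::real}.
        h ((1 - t) *\<^sub>R x + t *\<^sub>R y) \<le> ereal (1 - t) * h x + ereal t * h y)"

definition strictly_convex_on :: "'a::euclidean_space set \<Rightarrow> ('a \<Rightarrow> ereal) \<Rightarrow> bool" where
  "strictly_convex_on C h \<longleftrightarrow>
     (\<forall>x\<in>C. \<forall>y\<in>C. \<forall>t\<in>{0<..<1::real}. x \<noteq> y \<longrightarrow>
        h ((1 - t) *\<^sub>R x + t *\<^sub>R y) < ereal (1 - t) * h x + ereal t * h y)"

definition Gamma0 :: "('a::euclidean_space \<Rightarrow> ereal) set" where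
  "Gamma0 = {h. proper_fun h \<and> lsc_fun h \<and> convex_efun h}"

(* Meaningful only where f is differentiable. *)
definition gradient :: "('a::euclidean_space \<Rightarrow> real) \<Rightarrow> 'a \<Rightarrow> 'a" where
  "gradient f x = (THE D. GDERIV f x :> D)"

(* The real-valued representative of h; for proper h it agrees with h on edom h, so on the
   interior of edom h its derivative is that of h. *)
abbreviation real_part :: "('a \<Rightarrow> ereal) \<Rightarrow> 'a \<Rightarrow> real" where
  "real_part h \<equiv> (\<lambda>x. real_of_ereal (h x))"

definition essentially_smooth :: "('a::euclidean_space \<Rightarrow> ereal) \<Rightarrow> bool" where
  "essentially_smooth h \<longleftrightarrow>
     h \<in> Gamma0 \<and>
     (\<forall>x\<in>interior (edom h). real_part h differentiable (at x)) \<and>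
     (\<forall>(u :: nat \<Rightarrow> 'a) x. (\<forall>k. u k \<in> interior (edom h)) \<and> u \<longlonglongrightarrow> x \<and> x \<in> frontier (edom h)
        \<longrightarrow> filterlim (\<lambda>k. norm (gradient (real_part h) (u k))) at_top sequentially)"

definition legendre :: "('a::euclidean_space \<Rightarrow> ereal) \<Rightarrow> bool" where
  "legendre h \<longleftrightarrow> essentially_smooth h \<and> strictly_convex_on (interior (edom h)) h"

(* Meaningful for Legendre h, x in edom h and y in interior (edom h). *)
definition bregman_dist :: "('a::euclidean_space \<Rightarrow> ereal) \<Rightarrow> 'a \<Rightarrow> 'a \<Rightarrow> real" where
  "bregman_dist h x y =
     real_of_ereal (h x) - real_of_ereal (h y) - inner (gradient (real_part h) y) (x - y)"

definition bregman_tangent ::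
  "('a::euclidean_space \<Rightarrow> real) \<Rightarrow> ('a \<Rightarrow> ereal) \<Rightarrow> 'a \<Rightarrow> 'a \<Rightarrow> real" where
  "bregman_tangent f h z x = f z + inner (gradient f z) (x - z) + bregman_dist h x z"

(* The function x \<mapsto> bregman_tangent f h z x is a majorant of f at z on D associated with h.
   The condition D \<subseteq> edom h makes explicit that the Bregman distance is defined on D \<times> {z};
   as D is open, it also gives z \<in> interior (edom h). *)
definition bregman_tangent_majorant ::
  "'a::euclidean_space set \<Rightarrow> ('a \<Rightarrow> real) \<Rightarrow> ('a \<Rightarrow> ereal) \<Rightarrow> 'a \<Rightarrow> bool" where
  "bregman_tangent_majorant D f h z \<longleftrightarrow>
     open D \<and> (\<forall>x\<in>D. f differentiable (at x)) \<and> z \<in> D \<and> legendre h \<and> D \<subseteq> edom h \<and>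
     (\<forall>x\<in>D. f x \<le> bregman_tangent f h z x)"

definition bregman_le ::
  "('a::euclidean_space \<Rightarrow> ereal) \<Rightarrow> ('a \<Rightarrow> ereal) \<Rightarrow> bool" (infix "\<preceq>\<^sub>B" 50) where
  "h1 \<preceq>\<^sub>B h2 \<longleftrightarrow>
     legendre h1 \<and> legendre h2 \<and>
     (\<forall>x\<in>edom h1 \<inter> edom h2. \<forall>y\<in>interior (edom h1) \<inter> interior (edom h2).
        bregman_dist h1 x y \<le> bregman_dist h2 x y)"

section \<open>The Poisson log-likelihood and its majorants\<close>

definition zeta :: "real^'n^'m \<Rightarrow> 'm::finite \<Rightarrow> real" where
  "zeta H m = 1 / (\<Sum>n\<in>UNIV. H $ m $ n)"

definition rho :: "real^'n^'m \<Rightarrow> real^'m \<Rightarrow> real" where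
  "rho H b = Min (range (\<lambda>m. zeta H m * b $ m))"

(* The function of interest is the restriction of ell to {x. \<forall>n. - rho H b < x $ n}, where all
   arguments of ln are positive. *)
definition ell :: "real^'n^'m \<Rightarrow> nat^'m \<Rightarrow> real^'m \<Rightarrow> real^'n \<Rightarrow> real" where
  "ell H y b x = - (\<Sum>m\<in>UNIV. real (y $ m) * ln ((H *v x) $ m + b $ m))"

definition pos_orthant :: "(real^'n) set" where
  "pos_orthant = {x. \<forall>n. 0 < x $ n}"

definition a1 :: "real^'n^'m \<Rightarrow> nat^'m \<Rightarrow> real^'m \<Rightarrow> real^'n \<Rightarrow> 'n \<Rightarrow> real" where
  "a1 H y b z n =
     (\<Sum>m\<in>UNIV. real (y $ m) * (H $ m $ n * (z $ n + zeta H m * b $ m) / ((H *v z) $ m + b $ m)))"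

definition a6 :: "real^'n^'m \<Rightarrow> nat^'m \<Rightarrow> real^'m \<Rightarrow> real^'n \<Rightarrow> 'n \<Rightarrow> real" where
  "a6 H y b z n =
     (\<Sum>m\<in>UNIV. real (y $ m) * (H $ m $ n * z $ n / ((H *v z) $ m + b $ m)))"

definition h1 :: "real^'n^'m \<Rightarrow> nat^'m \<Rightarrow> real^'m \<Rightarrow> real^'n \<Rightarrow> real^'n \<Rightarrow> ereal" where
  "h1 H y b z x =
     (if \<forall>n. - rho H b < x $ n
      then ereal (- (\<Sum>n\<in>UNIV. a1 H y b z n * ln (x $ n + rho H b))) else \<infinity>)"

definition h5 :: "real^'n^'m \<Rightarrow> nat^'m \<Rightarrow> real^'m \<Rightarrow> real^'n \<Rightarrow> real^'n \<Rightarrow> ereal" where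
  "h5 H y b z x =
     (if x \<in> pos_orthant then ereal (- (\<Sum>n\<in>UNIV. a1 H y b z n * ln (x $ n))) else \<infinity>)"

definition h6 :: "real^'n^'m \<Rightarrow> nat^'m \<Rightarrow> real^'m \<Rightarrow> real^'n \<Rightarrow> real^'n \<Rightarrow> ereal" where
  "h6 H y b z x =
     (if x \<in> pos_orthant then ereal (- (\<Sum>n\<in>UNIV. a6 H y b z n * ln (x $ n))) else \<infinity>)"

end

theory Submission
  imports Defs
begin

text \<open>
  All three functions are logarithmic barriers \<open>- \<Sum>n. c n * ln (x $ n + r)\<close>, whose Bregman
  distance is \<open>\<Sum>n. c n * \<phi> ((x $ n + r) / (y $ n + r))\<close> with \<open>\<phi> t = t - 1 - ln t \<ge> 0\<close>. The order
  relations follow because this is monotone in \<open>c\<close> and antitone in \<open>r\<close>. For (Maj-6), the choice of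
  \<open>a6\<close> makes the linear part of the Bregman distance cancel the gradient term of \<open>ell\<close>, and what
  remains is Jensen's inequality for \<open>ln\<close>, with \<open>(H\<^sub>m x + b\<^sub>m) / (H\<^sub>m z + b\<^sub>m)\<close> written as a convex
  combination of the ratios \<open>x $ n / z $ n\<close> and \<open>1\<close>. (Maj-5) then follows from (Maj-6) and
  \<open>a6 \<le> a1\<close>.
\<close>

section \<open>Logarithmic barriers\<close>

lemma gradient_eqI:
  assumes "GDERIV f x :> D"
  shows "gradient f x = D"
  unfolding gradient_def
proof (rule the_equality)
  show "GDERIV f x :> D" by (fact assms)
  fix E assume "GDERIV f x :> E"
  then have "(\<lambda>h. inner h E) = (\<lambda>h. inner h D)"
    using assms unfolding gderiv_def by (rule has_derivative_unique)
  then show "E = D"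
    by (metis vector_eq_ldot)
qed

lemma GDERIV_transform_open:
  assumes "GDERIV f x :> D" "open S" "x \<in> S" "\<And>w. w \<in> S \<Longrightarrow> f w = g w"
  shows "GDERIV g x :> D"
  using assms unfolding gderiv_def by (rule has_derivative_transform_within_open)

text \<open>General affine forms let one computation serve both the barriers, with
  \<open>v n = axis n 1\<close>, and \<open>ell\<close>, with the rows
  \<open>v m = H $ m\<close>.\<close>

lemma GDERIV_sum_ln_affine:
  fixes v :: "'i::finite \<Rightarrow> 'a::euclidean_space"
  assumes "\<And>i. 0 < inner (v i) x + b i"
  shows "GDERIV (\<lambda>x. - (\<Sum>i\<in>UNIV. c i * ln (inner (v i) x + b i))) x :>
           - (\<Sum>i\<in>UNIV. (c i / (inner (v i) x + b i)) *\<^sub>R v i)"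
  unfolding gderiv_def
  using assms
  by (auto intro!: derivative_eq_intros ext
      simp: inner_sum_right inner_commute divide_simps)

text \<open>The graph of \<open>ln\<close> lies below its tangent at the weighted mean
  \<open>w\<close>, and the linear parts of the two tangent bounds average to zero. Strictness comes
  from \<open>ln s = s - 1\<close> only at \<open>s = 1\<close>, together with
  \<open>u / w \<noteq> 1\<close>.\<close>

lemma ln_convex_combination_ge:
  fixes u v t :: real
  assumes "0 < u" "0 < v" "0 < t" "t < 1"
  shows "(1 - t) * ln u + t * ln v \<le> ln ((1 - t) * u + t * v)"
    and "u \<noteq> v \<Longrightarrow> (1 - t) * ln u + t * ln v < ln ((1 - t) * u + t * v)"
proof -
  define w where "w = (1 - t) * u + t * v"
  have w: "0 < w" using assms by (simp add: w_def add_pos_pos)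
  have tangent: "(1 - t) * (u / w - 1) + t * (v / w - 1) = 0"
    using w by (simp add: w_def field_simps)
  have u: "ln u - ln w \<le> u / w - 1" and v: "ln v - ln w \<le> v / w - 1"
    using assms w ln_le_minus_one[of "u / w"] ln_le_minus_one[of "v / w"] by (simp_all add: ln_div)
  have "(1 - t) * (ln u - ln w) + t * (ln v - ln w) \<le> 0"
    unfolding tangent[symmetric] using u v assms by (intro add_mono mult_left_mono) auto
  then show "(1 - t) * ln u + t * ln v \<le> ln ((1 - t) * u + t * v)"
    unfolding w_def[symmetric] by (simp add: algebra_simps)
  assume "u \<noteq> v"
  then have "u \<noteq> w"
    using assms by (auto simp: w_def algebra_simps)
  then have "ln u - ln w \<noteq> u / w - 1"
    using assms w ln_eq_minus_one[of "u / w"] by (auto simp: ln_div)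
  then have "ln u - ln w < u / w - 1" using u by simp
  then have "(1 - t) * (ln u - ln w) + t * (ln v - ln w) < 0"
    unfolding tangent[symmetric] using v assms
    by (intro add_less_le_mono mult_strict_left_mono mult_left_mono) auto
  then show "(1 - t) * ln u + t * ln v < ln ((1 - t) * u + t * v)"
    unfolding w_def[symmetric] by (simp add: algebra_simps)
qed

section \<open>Domain, gradient and Bregman distance of a barrier\<close>

definition log_barrier :: "('n \<Rightarrow> real) \<Rightarrow> real \<Rightarrow> real^'n \<Rightarrow> ereal" where
  "log_barrier c r x =
     (if \<forall>n. - r < x $ n then ereal (- (\<Sum>n\<in>UNIV. c n * ln (x $ n + r))) else \<infinity>)"

lemma log_barrier_eq:
  "\<forall>n. - r < x $ n \<Longrightarrow> log_barrier c r x = ereal (- (\<Sum>n\<in>UNIV. c n * ln (x $ n + r)))"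
  by (simp add: log_barrier_def)

lemma edom_log_barrier: "edom (log_barrier c r) = {x. \<forall>n. - r < x $ n}"
  by (auto simp: edom_def log_barrier_def)

lemma open_orthant: "open {x::real^'n. \<forall>n. - r < x $ n}"
proof -
  have "{x::real^'n. \<forall>n. - r < x $ n} = (\<Inter>n. {x. - r < x $ n})" by auto
  moreover have "open (\<Inter>n. {x::real^'n. - r < x $ n})"
    by (intro open_INT open_Collect_less continuous_intros ballI) auto
  ultimately show ?thesis by simp
qed

lemma interior_edom_log_barrier:
  "interior (edom (log_barrier c r)) = {x. \<forall>n. - r < x $ n}"
  by (simp add: edom_log_barrier interior_open open_orthant)

lemma GDERIV_log_barrier:
  fixes x :: "real^'n"
  assumes x: "\<forall>n. - r < x $ n"
  shows "GDERIV (real_part (log_barrier c r)) x :> (\<chi> n. - (c n / (x $ n + r)))"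
proof -
  have inner: "inner (axis n 1) x = x $ n" for n
    by (simp add: inner_axis')
  have pos: "0 < inner (axis n 1) x + r" for n
    using x[rule_format, of n] by (simp add: inner)
  have grad: "- (\<Sum>n\<in>UNIV. (c n / (inner (axis n 1) x + r)) *\<^sub>R axis n 1)
      = (\<chi> n. - (c n / (x $ n + r)))"
    unfolding inner
    by (simp add: vec_eq_iff axis_def if_distrib[where f="\<lambda>t. _ * t"] cong: if_cong)
  have "GDERIV (\<lambda>x. - (\<Sum>n\<in>UNIV. c n * ln (inner (axis n 1) x + r))) x :>
      (\<chi> n. - (c n / (x $ n + r)))"
    using GDERIV_sum_ln_affine[of "\<lambda>n. axis n 1" x "\<lambda>_. r" c] pos by (simp only: grad)
  \<comment> \<open>Outside the orthant \<open>real_of_ereal \<infinity>\<close> is the default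
    value 0, so the closed formula is transferred only within the open orthant around
    \<open>x\<close>.\<close>
  then show ?thesis
    by (rule GDERIV_transform_open[OF _ open_orthant[of r]])
       (use x in \<open>auto simp: log_barrier_eq inner_axis'\<close>)
qed

lemma gradient_log_barrier:
  "\<forall>n. - r < x $ n \<Longrightarrow>
     gradient (real_part (log_barrier c r)) x = (\<chi> n. - (c n / (x $ n + r)))"
  by (rule gradient_eqI[OF GDERIV_log_barrier])

lemma differentiable_log_barrier:
  "\<forall>n. - r < x $ n \<Longrightarrow> real_part (log_barrier c r) differentiable (at x)"
  using GDERIV_log_barrier unfolding gderiv_def differentiable_def by blast

text \<open>The difference of the logarithms is the logarithm of the ratio, and the gradient term
  gives the ratio minus 1. This separable form reduces every comparison of distances to one
  coordinate.\<close>

lemma bregman_dist_log_barrier: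
  fixes x y :: "real^'n"
  assumes x: "\<forall>n. - r < x $ n" and y: "\<forall>n. - r < y $ n"
  shows "bregman_dist (log_barrier c r) x y =
    (\<Sum>n\<in>UNIV. c n * ((x $ n + r) / (y $ n + r) - 1 - ln ((x $ n + r) / (y $ n + r))))"
proof -
  have "c n * ((x $ n + r) / (y $ n + r) - 1 - ln ((x $ n + r) / (y $ n + r))) =
     - (c n * ln (x $ n + r)) + c n * ln (y $ n + r) + c n / (y $ n + r) * (x $ n - y $ n)" for n
  proof -
    have "0 < x $ n + r" "0 < y $ n + r"
      using x[rule_format, of n] y[rule_format, of n] by simp_all
    then show ?thesis by (simp add: ln_div field_simps)
  qed
  then show ?thesis
    by (simp add: bregman_dist_def log_barrier_eq x y gradient_log_barrier inner_vec_def
        sum.distrib sum_negf sum_subtractf)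
qed

section \<open>Convexity, lower semicontinuity and the Legendre property\<close>

lemma convex_combination_orthant:
  fixes u v :: "real^'n"
  assumes "\<forall>n. - r < u $ n" "\<forall>n. - r < v $ n" "0 < t" "t < 1"
  shows "- r < ((1 - t) *\<^sub>R u + t *\<^sub>R v) $ n"
proof -
  have "0 < u $ n + r" "0 < v $ n + r"
    using assms(1,2)[rule_format, of n] by simp_all
  then have "0 < (1 - t) * (u $ n + r) + t * (v $ n + r)"
    using assms(3,4) by (simp add: add_pos_pos)
  then show ?thesis by (simp add: algebra_simps)
qed

text \<open>Concavity of \<open>ln\<close> gives a weak inequality in every coordinate and a strict
  one in a coordinate \<open>k\<close> where \<open>u\<close> and \<open>v\<close> differ; positive
  weights preserve both.\<close>

lemma log_barrier_convex_combination:
  fixes u v :: "real^'n"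
  assumes c: "\<And>n. 0 < c n" and u: "\<forall>n. - r < u $ n" and v: "\<forall>n. - r < v $ n"
    and t: "0 < t" "t < 1" and "u \<noteq> v"
  shows "log_barrier c r ((1 - t) *\<^sub>R u + t *\<^sub>R v)
    < ereal (1 - t) * log_barrier c r u + ereal t * log_barrier c r v"
proof -
  let ?w = "(1 - t) *\<^sub>R u + t *\<^sub>R v"
  have pos: "0 < u $ n + r" "0 < v $ n + r" for n
    using u[rule_format, of n] v[rule_format, of n] by simp_all
  have w: "?w $ n + r = (1 - t) * (u $ n + r) + t * (v $ n + r)" for n
    by (simp add: algebra_simps)
  obtain k where k: "u $ k \<noteq> v $ k" using \<open>u \<noteq> v\<close> by (auto simp: vec_eq_iff)
  have "(\<Sum>n\<in>UNIV. c n * ((1 - t) * ln (u $ n + r) + t * ln (v $ n + r)))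
      < (\<Sum>n\<in>UNIV. c n * ln (?w $ n + r))"
  proof (rule sum_strict_mono_ex1)
    show "\<forall>n\<in>UNIV. c n * ((1 - t) * ln (u $ n + r) + t * ln (v $ n + r)) \<le> c n * ln (?w $ n + r)"
      unfolding w using c pos t
      by (intro ballI mult_left_mono ln_convex_combination_ge(1)) (auto simp: less_imp_le)
    show "\<exists>n\<in>UNIV. c n * ((1 - t) * ln (u $ n + r) + t * ln (v $ n + r)) < c n * ln (?w $ n + r)"
      unfolding w using c pos t k
      by (intro bexI[of _ k] mult_strict_left_mono ln_convex_combination_ge(2)) auto
  qed simp
  also have "(\<Sum>n\<in>UNIV. c n * ((1 - t) * ln (u $ n + r) + t * ln (v $ n + r)))
      = (1 - t) * (\<Sum>n\<in>UNIV. c n * ln (u $ n + r)) + t * (\<Sum>n\<in>UNIV. c n * ln (v $ n + r))"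
    by (simp add: sum_distrib_left sum.distrib[symmetric] algebra_simps)
  finally show ?thesis
    using convex_combination_orthant[OF u v t] by (simp add: log_barrier_eq u v)
qed

lemma convex_log_barrier:
  fixes c :: "'n::finite \<Rightarrow> real"
  assumes c: "\<And>n. 0 < c n"
  shows "convex_efun (log_barrier c r)"
  unfolding convex_efun_def
proof (intro allI ballI)
  fix u v :: "real^'n" and t :: real
  assume "t \<in> {0..1}"
  then consider "t = 0" | "t = 1" | "0 < t" "t < 1" by fastforce
  then show "log_barrier c r ((1 - t) *\<^sub>R u + t *\<^sub>R v)
    \<le> ereal (1 - t) * log_barrier c r u + ereal t * log_barrier c r v"
  proof cases
    case 3
    show ?thesis
    \<comment> \<open>Strict convexity covers distinct points of the domain. If an endpoint is
      outside, the right-hand side is \<open>\<infinity>\<close>, since both coefficients are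
      positive. Equal points of the domain remain.\<close>
    proof (cases "u = v \<and> (\<forall>n. - r < u $ n)")
      case True
      then have "(1 - t) *\<^sub>R u + t *\<^sub>R v = u" by (simp flip: scaleR_add_left)
      moreover have "log_barrier c r u = ereal (- (\<Sum>n\<in>UNIV. c n * ln (u $ n + r)))"
        using True by (intro log_barrier_eq) blast
      ultimately show ?thesis using True by (auto simp: algebra_simps)
    next
      case False
      then consider "u \<noteq> v" "\<forall>n. - r < u $ n" "\<forall>n. - r < v $ n"
        | "\<not> (\<forall>n. - r < u $ n)" | "\<not> (\<forall>n. - r < v $ n)" by blast
      then show ?thesis
      proof cases
        case 1
        then show ?thesis using log_barrier_convex_combination[of c, OF c] 3 by (simp add: less_imp_le)
      qed (use 3 in \<open>auto simp: log_barrier_def\<close>)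
    qed
  qed (simp_all add: zero_ereal_def[symmetric] one_ereal_def[symmetric])
qed

text \<open>Near \<open>x\<close>, coordinate \<open>k\<close> either leaves the domain, where the
  value is \<open>\<infinity>\<close>, or has a very small \<open>w $ k + r\<close>, so that its
  term is huge. The other terms cannot compensate: by \<open>ln s \<le> s\<close> their weighted
  logarithms sum to at most \<open>g w\<close>, which is continuous and hence locally
  bounded.\<close>

lemma tendsto_log_barrier_outside:
  fixes x :: "real^'n"
  assumes c: "\<And>n. 0 < c n" and x: "x $ k \<le> - r"
  shows "(log_barrier c r \<longlongrightarrow> \<infinity>) (at x)"
  unfolding tendsto_PInfty
proof
  fix K :: real
  define g where "g w = (\<Sum>n\<in>UNIV - {k}. c n * (w $ n + r))" for w :: "real^'n"
  have coord: "((\<lambda>w. w $ n) \<longlongrightarrow> x $ n) (at x)" for n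
    by (intro tendsto_intros)
  have "(g \<longlongrightarrow> g x) (at x)"
    unfolding g_def by (intro tendsto_intros)
  then have "\<forall>\<^sub>F w in at x. g w < g x + 1"
    by (rule order_tendstoD) simp
  \<comment> \<open>The threshold makes \<open>c k * ln (w $ k + r)\<close> smaller than
    \<open>- (K + g x + 1)\<close>; the other terms cost less than \<open>g x + 1\<close>, so the
    barrier exceeds \<open>K\<close>.\<close>
  moreover have "\<forall>\<^sub>F w in at x. w $ k < - r + exp (- (K + g x + 1) / c k)"
    using le_less_trans[OF x, of "- r + exp (- (K + g x + 1) / c k)"]
    by (intro order_tendstoD[OF coord]) simp
  ultimately show "\<forall>\<^sub>F w in at x. ereal K < log_barrier c r w"
  proof eventually_elim
    case (elim w)
    show ?case
    proof (cases "\<forall>n. - r < w $ n")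
      case True
      have pos: "0 < w $ n + r" for n
        using True[rule_format, of n] by simp
      have "ln (w $ k + r) < - (K + g x + 1) / c k"
        using elim(2) ln_ge_iff[OF pos[of k], of "- (K + g x + 1) / c k"] by linarith
      then have "c k * ln (w $ k + r) < - (K + g x + 1)"
        using c[of k] by (simp add: field_simps)
      moreover have "(\<Sum>n\<in>UNIV - {k}. c n * ln (w $ n + r)) \<le> g w"
        unfolding g_def using c pos
        by (intro sum_mono mult_left_mono) (auto simp: less_imp_le intro: ln_bound)
      moreover have "(\<Sum>n\<in>UNIV. c n * ln (w $ n + r)) =
          c k * ln (w $ k + r) + (\<Sum>n\<in>UNIV - {k}. c n * ln (w $ n + r))"
        by (rule sum.remove) auto
      ultimately show ?thesis
        using elim(1) True by (simp add: log_barrier_eq)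
    qed (auto simp: log_barrier_def)
  qed
qed

text \<open>The barrier is even continuous as an extended-real function: by differentiability on the
  open domain, and by divergence to \<open>\<infinity>\<close> at all other points.\<close>

lemma lsc_log_barrier:
  fixes c :: "'n::finite \<Rightarrow> real"
  assumes c: "\<And>n. 0 < c n"
  shows "lsc_fun (log_barrier c r)"
  unfolding lsc_fun_def
proof
  fix x :: "real^'n"
  have "(log_barrier c r \<longlongrightarrow> log_barrier c r x) (at x)"
  proof (cases "\<forall>n. - r < x $ n")
    case True
    have "isCont (real_part (log_barrier c r)) x"
      by (intro differentiable_imp_continuous_within differentiable_log_barrier True)
    then have "((\<lambda>w. ereal (real_part (log_barrier c r) w)) \<longlongrightarrow>
        ereal (real_part (log_barrier c r) x)) (at x)"
      by (simp add: isCont_def)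
    moreover have "\<forall>\<^sub>F w in at x. ereal (real_part (log_barrier c r) w) = log_barrier c r w"
      using True by (intro eventually_at_in_open'[OF open_orthant[of r], THEN eventually_mono])
        (auto simp: log_barrier_eq)
    ultimately have "(log_barrier c r \<longlongrightarrow> ereal (real_part (log_barrier c r) x)) (at x)"
      by (rule Lim_transform_eventually)
    then show ?thesis
      using True by (simp add: log_barrier_eq)
  next
    case False
    then obtain k where "x $ k \<le> - r" by (auto simp: not_less)
    then show ?thesis
      using tendsto_log_barrier_outside[of c, OF c] False by (auto simp: log_barrier_def)
  qed
  then have "Liminf (at x) (log_barrier c r) = log_barrier c r x"
    by (intro lim_imp_Liminf) simp_all
  then show "log_barrier c r x \<le> Liminf (at x) (log_barrier c r)" by simp
qed

text \<open>Essential smoothness rests on one coordinate: a boundary point has some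
  \<open>x $ j = - r\<close>, where the gradient component of absolute value
  \<open>c j / (u k $ j + r)\<close> blows up and bounds the norm from below.\<close>

lemma legendre_log_barrier:
  fixes c :: "'n::finite \<Rightarrow> real"
  assumes c: "\<And>n. 0 < c n"
  shows "legendre (log_barrier c r)"
proof -
  have "(\<chi> n. 1 - r) \<in> edom (log_barrier c r)" by (simp add: edom_log_barrier)
  then have "proper_fun (log_barrier c r)"
    unfolding proper_fun_def by (auto simp: log_barrier_def)
  then have "log_barrier c r \<in> Gamma0"
    using lsc_log_barrier[of c, OF c] convex_log_barrier[of c, OF c] by (simp add: Gamma0_def)
  moreover have "filterlim (\<lambda>k. norm (gradient (real_part (log_barrier c r)) (u k))) at_top sequentially"
    if u: "\<And>k. u k \<in> interior (edom (log_barrier c r))" and lim: "u \<longlonglongrightarrow> x"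
      and x: "x \<in> frontier (edom (log_barrier c r))" for u :: "nat \<Rightarrow> real^'n" and x
  proof -
    have dom: "\<forall>n. - r < u k $ n" for k
      using u[of k] by (simp add: interior_edom_log_barrier)
    have "x \<notin> interior (edom (log_barrier c r))" using x by (simp add: frontier_def)
    then obtain j where j: "x $ j \<le> - r" by (auto simp: interior_edom_log_barrier not_less)
    have limj: "(\<lambda>k. u k $ j) \<longlonglongrightarrow> x $ j" by (intro tendsto_intros lim)
    have "- r \<le> x $ j"
      using dom by (intro LIMSEQ_le_const[OF limj]) (auto intro: less_imp_le)
    with j have "x $ j = - r" by simp
    then have "(\<lambda>k. u k $ j + r) \<longlonglongrightarrow> 0"
      using tendsto_add[OF limj tendsto_const[of r]] by simp
    moreover have pos: "0 < u k $ j + r" for k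
      using dom[of k, rule_format, of j] by simp
    ultimately have "filterlim (\<lambda>k. c j / (u k $ j + r)) at_top sequentially"
      using c[of j] by (intro LIM_at_top_divide[OF tendsto_const]) simp_all
    then show ?thesis
    proof (rule filterlim_at_top_mono, intro always_eventually allI)
      fix k
      have "c j / (u k $ j + r) = \<bar>gradient (real_part (log_barrier c r)) (u k) $ j\<bar>"
        using c[of j] pos[of k] by (simp add: gradient_log_barrier[OF dom])
      then show "c j / (u k $ j + r) \<le> norm (gradient (real_part (log_barrier c r)) (u k))"
        using component_le_norm_cart by metis
    qed
  qed
  ultimately have "essentially_smooth (log_barrier c r)"
    unfolding essentially_smooth_def
    by (auto simp: interior_edom_log_barrier differentiable_log_barrier)
  then show ?thesis
    unfolding legendre_def strictly_convex_on_def
    using log_barrier_convex_combination[of c, OF c]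
    by (auto simp: interior_edom_log_barrier)
qed

section \<open>Comparison of barriers in the Bregman order\<close>

lemma minus_one_minus_ln_nonneg: "0 < t \<Longrightarrow> 0 \<le> t - 1 - ln (t::real)"
  using ln_le_minus_one[of t] by simp

lemma bregman_le_log_barrier_weights:
  fixes c d :: "'n::finite \<Rightarrow> real"
  assumes c: "\<And>n. 0 < c n" and cd: "\<And>n. c n \<le> d n"
  shows "log_barrier c r \<preceq>\<^sub>B log_barrier d r"
proof -
  have "bregman_dist (log_barrier c r) x y \<le> bregman_dist (log_barrier d r) x y"
    if x: "\<forall>n. - r < x $ n" and y: "\<forall>n. - r < y $ n" for x y
  proof -
    have "0 < (x $ n + r) / (y $ n + r)" for n
      using x[rule_format, of n] y[rule_format, of n] by simp
    then show ?thesis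
      using x y cd by (auto simp: bregman_dist_log_barrier
          intro!: sum_mono mult_right_mono minus_one_minus_ln_nonneg)
  qed
  moreover have "0 < d n" for n using c cd less_le_trans by blast
  ultimately show ?thesis
    unfolding bregman_le_def interior_edom_log_barrier
    unfolding edom_log_barrier
    using c by (auto simp: legendre_log_barrier)
qed

text \<open>A smaller shift moves the ratio farther from 1 on the same side:
  \<open>(q - p) * (p - 1) \<ge> 0\<close>. Bounding \<open>ln (q / p)\<close> by
  \<open>q / p - 1\<close>, the right side minus the left is at least
  \<open>(q - p) * (p - 1) / p\<close>.\<close>

lemma minus_one_minus_ln_shift_le:
  fixes x y r s :: real
  assumes "0 < x + s" "0 < y + s" "s \<le> r"
  shows "(x + r) / (y + r) - 1 - ln ((x + r) / (y + r))
    \<le> (x + s) / (y + s) - 1 - ln ((x + s) / (y + s))"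
proof -
  define p q where "p = (x + r) / (y + r)" and "q = (x + s) / (y + s)"
  have p: "0 < p" and q: "0 < q" using assms by (simp_all add: p_def q_def)
  have "q - p = (r - s) * (x - y) / ((y + r) * (y + s))" "p - 1 = (x - y) / (y + r)"
    using assms by (simp_all add: p_def q_def divide_simps) algebra
  then have "(q - p) * (p - 1) = (r - s) * (x - y)\<^sup>2 / ((y + r)\<^sup>2 * (y + s))"
    by (simp add: power2_eq_square mult_ac)
  then have "0 \<le> (q - p) * (p - 1)"
    using assms by simp
  then have "0 \<le> (q - p) - (q / p - 1)"
    using p by (simp add: field_simps)
  moreover have "ln q - ln p \<le> q / p - 1"
    using ln_le_minus_one[of "q / p"] p q by (simp add: ln_div)
  ultimately show ?thesis
    unfolding p_def[symmetric] q_def[symmetric] by simp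
qed

text \<open>As \<open>s \<le> r\<close>, the common domain is the orthant belonging to
  \<open>s\<close>, and the scalar inequality applies there coordinatewise.\<close>

lemma bregman_le_log_barrier_shift:
  fixes c :: "'n::finite \<Rightarrow> real"
  assumes c: "\<And>n. 0 < c n" and sr: "s \<le> r"
  shows "log_barrier c r \<preceq>\<^sub>B log_barrier c s"
proof -
  have "bregman_dist (log_barrier c r) x y \<le> bregman_dist (log_barrier c s) x y"
    if x: "\<forall>n. - s < x $ n" and y: "\<forall>n. - s < y $ n" for x y
  proof -
    have "- r < x $ n" "- r < y $ n" "0 < x $ n + s" "0 < y $ n + s" for n
      using x[rule_format, of n] y[rule_format, of n] sr by simp_all
    then show ?thesis
      using x y c sr
      by (auto simp: bregman_dist_log_barrier less_imp_le
          intro!: sum_mono mult_left_mono minus_one_minus_ln_shift_le)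
  qed
  then show ?thesis
    unfolding bregman_le_def interior_edom_log_barrier
    unfolding edom_log_barrier
    using c by (auto simp: legendre_log_barrier)
qed

section \<open>The Poisson log-likelihood\<close>

lemma bregman_tangent_majorant_mono:
  assumes maj: "bregman_tangent_majorant D f g z" and gh: "g \<preceq>\<^sub>B h" and D: "D \<subseteq> edom h"
  shows "bregman_tangent_majorant D f h z"
proof -
  have "open D" "z \<in> D" "D \<subseteq> edom g"
    using maj by (auto simp: bregman_tangent_majorant_def)
  \<comment> \<open>The open set \<open>D\<close> lies in both domains, so \<open>z\<close> is
    interior to both, as the order relation requires.\<close>
  then have "bregman_dist g x z \<le> bregman_dist h x z" if "x \<in> D" for x
    using that gh D interior_maximal[of D] unfolding bregman_le_def by blast
  then show ?thesis
    using maj gh D unfolding bregman_tangent_majorant_def bregman_le_def bregman_tangent_def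
    by (meson add_left_mono order_trans)
qed

locale poisson_model =
  fixes H :: "real^'n^'m" and y :: "nat^'m" and b :: "real^'m" and z :: "real^'n"
  assumes H_nonneg: "0 \<le> H $ m $ n"
    and b_pos: "0 < b $ m"
    and row_sums: "0 < (\<Sum>n\<in>UNIV. H $ m $ n)"
    and HTy_pos: "0 < (transpose H *v (\<chi> m. real (y $ m))) $ n"
    and z: "z \<in> pos_orthant"
begin

section \<open>Positivity of the intensities and of the barrier weights\<close>

lemma intensity_pos: "x \<in> pos_orthant \<Longrightarrow> 0 < (H *v x) $ m + b $ m"
  using H_nonneg b_pos
  by (auto simp: matrix_vector_mult_def pos_orthant_def less_imp_le intro!: add_nonneg_pos sum_nonneg)

lemma zeta_pos: "0 < zeta H m"
  using row_sums by (simp add: zeta_def)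

lemma rho_pos: "0 < rho H b"
  using zeta_pos b_pos by (auto simp: rho_def)

lemma a6_pos: "0 < a6 H y b z n"
proof -
  have nonneg: "0 \<le> real (y $ m) * (H $ m $ n * z $ n / ((H *v z) $ m + b $ m))" for m
    using H_nonneg intensity_pos[OF z, of m] z by (simp add: pos_orthant_def less_imp_le)
  have "(\<Sum>m\<in>UNIV. H $ m $ n * real (y $ m)) \<noteq> 0"
    using HTy_pos[of n] by (simp add: matrix_vector_mult_def transpose_def)
  \<comment> \<open>A nonzero component of the transposed product must have a nonzero summand; the
    same \<open>m\<close> gives a positive summand of \<open>a6\<close>.\<close>
  then obtain m where "H $ m $ n * real (y $ m) \<noteq> 0"
    by (rule sum.not_neutral_contains_not_neutral)
  then have "real (y $ m) * (H $ m $ n * z $ n / ((H *v z) $ m + b $ m)) \<noteq> 0"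
    using intensity_pos[OF z, of m] z by (auto simp: pos_orthant_def less_imp_neq[symmetric])
  then have "0 < real (y $ m) * (H $ m $ n * z $ n / ((H *v z) $ m + b $ m))"
    using nonneg[of m] by linarith
  then show ?thesis
    unfolding a6_def using nonneg by (intro sum_pos2[of _ m]) auto
qed

lemma a6_le_a1: "a6 H y b z n \<le> a1 H y b z n"
  unfolding a6_def a1_def
  using H_nonneg intensity_pos[OF z] zeta_pos b_pos
  by (intro sum_mono mult_left_mono divide_right_mono) (simp_all add: less_imp_le)

lemma a1_pos: "0 < a1 H y b z n"
  using a6_pos a6_le_a1 by (rule less_le_trans)

lemma h1_eq: "h1 H y b z = log_barrier (a1 H y b z) (rho H b)"
  by (simp add: fun_eq_iff h1_def log_barrier_def)

lemma h5_eq: "h5 H y b z = log_barrier (a1 H y b z) 0"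
  by (simp add: fun_eq_iff h5_def log_barrier_def pos_orthant_def)

lemma h6_eq: "h6 H y b z = log_barrier (a6 H y b z) 0"
  by (simp add: fun_eq_iff h6_def log_barrier_def pos_orthant_def)

section \<open>Gradient and Jensen bound for the likelihood\<close>

lemma GDERIV_ell:
  assumes "x \<in> pos_orthant"
  shows "GDERIV (ell H y b) x :>
    - (\<Sum>m\<in>UNIV. (real (y $ m) / ((H *v x) $ m + b $ m)) *\<^sub>R H $ m)"
  using GDERIV_sum_ln_affine[of "\<lambda>m. H $ m" x "\<lambda>m. b $ m" "\<lambda>m. real (y $ m)"]
    intensity_pos[OF assms]
  by (simp add: ell_def[abs_def] matrix_vector_mul_component)

text \<open>This identity explains the choice of \<open>a6\<close>: its barrier with shift 0 has the
  same gradient at \<open>z\<close> as \<open>ell\<close>.\<close>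

lemma gradient_ell_eq_a6: "gradient (ell H y b) z $ n = - (a6 H y b z n / z $ n)"
proof -
  have "z $ n \<noteq> 0" using z by (auto simp: pos_orthant_def less_imp_neq[symmetric])
  then show ?thesis
    by (simp add: gradient_eqI[OF GDERIV_ell[OF z]] a6_def sum_divide_distrib)
qed

text \<open>The weights \<open>w n\<close> together with \<open>b $ m / B\<close> sum to 1, and the
  corresponding mean of the ratios \<open>x $ n / z $ n\<close> and 1 is \<open>A / B\<close>. The
  ratio 1 adds nothing to the left side because \<open>ln 1 = 0\<close>.\<close>

lemma ln_intensity_ratio_ge:
  assumes x: "x \<in> pos_orthant"
  shows "(\<Sum>n\<in>UNIV. H $ m $ n * z $ n / ((H *v z) $ m + b $ m) * ln (x $ n / z $ n))
    \<le> ln ((H *v x) $ m + b $ m) - ln ((H *v z) $ m + b $ m)"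
proof -
  define A B where "A = (H *v x) $ m + b $ m" and "B = (H *v z) $ m + b $ m"
  have A: "0 < A" and B: "0 < B"
    using intensity_pos x z by (simp_all add: A_def B_def)
  have xpos: "0 < x $ n" and zpos: "0 < z $ n" for n
    using x z by (auto simp: pos_orthant_def)
  \<comment> \<open>Jensen's inequality is obtained from the tangent of \<open>ln\<close> at the
    mean \<open>A / B\<close>.\<close>
  have ln_ratio: "ln t \<le> ln (A / B) + (t * (B / A) - 1)" if "0 < t" for t
    using ln_le_minus_one[of "t * (B / A)"] that A B by (simp add: ln_mult ln_div)
  define w where "w n = H $ m $ n * z $ n / B" for n
  have w: "0 \<le> w n" for n
    using H_nonneg zpos[of n] B by (simp add: w_def less_imp_le)
  have sum_w: "(\<Sum>n\<in>UNIV. w n) = 1 - b $ m / B"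
    using B by (simp add: w_def sum_divide_distrib[symmetric] B_def matrix_vector_mult_def field_simps)
  have sum_wx: "(\<Sum>n\<in>UNIV. w n * (x $ n / z $ n)) = A / B - b $ m / B"
  proof -
    have "w n * (x $ n / z $ n) = H $ m $ n * x $ n / B" for n
      using zpos[of n] by (simp add: w_def)
    then show ?thesis
      by (simp add: sum_divide_distrib[symmetric] A_def matrix_vector_mult_def diff_divide_distrib[symmetric])
  qed
  have "(\<Sum>n\<in>UNIV. w n * ln (x $ n / z $ n))
      \<le> (\<Sum>n\<in>UNIV. w n * (ln (A / B) + (x $ n / z $ n * (B / A) - 1)))"
    using w xpos zpos by (intro sum_mono mult_left_mono ln_ratio) auto
  also have "\<dots> = (\<Sum>n\<in>UNIV. w n) * (ln (A / B) - 1) + (\<Sum>n\<in>UNIV. w n * (x $ n / z $ n)) * (B / A)"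
    unfolding sum_distrib_right sum.distrib[symmetric]
    by (rule sum.cong) (simp_all add: algebra_simps)
  \<comment> \<open>The bracket is the tangent bound at \<open>t = 1\<close>, hence nonnegative; it
    enters with the missing weight \<open>b $ m / B\<close>.\<close>
  also have "\<dots> = ln (A / B) - b $ m / B * (ln (A / B) + (1 * (B / A) - 1))"
    unfolding sum_w sum_wx using A B by (simp add: field_simps)
  also have "\<dots> \<le> ln (A / B)"
    using ln_ratio[of 1] b_pos[of m] B by simp
  finally show ?thesis
    using A B by (simp add: w_def ln_div flip: A_def B_def)
qed

text \<open>Interchanging the sums splits the \<open>a6\<close> terms by row; the Jensen bounds of
  the rows are then added with the nonnegative weights \<open>y $ m\<close>.\<close>

lemma ell_le:
  assumes x: "x \<in> pos_orthant"
  shows "ell H y b x \<le> ell H y b z - (\<Sum>n\<in>UNIV. a6 H y b z n * ln (x $ n / z $ n))"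
proof -
  have "(\<Sum>n\<in>UNIV. a6 H y b z n * ln (x $ n / z $ n)) =
    (\<Sum>m\<in>UNIV. real (y $ m) *
      (\<Sum>n\<in>UNIV. H $ m $ n * z $ n / ((H *v z) $ m + b $ m) * ln (x $ n / z $ n)))"
    unfolding a6_def sum_distrib_right sum_distrib_left
    by (subst sum.swap) (simp add: mult.assoc)
  also have "\<dots> \<le> (\<Sum>m\<in>UNIV. real (y $ m) *
      (ln ((H *v x) $ m + b $ m) - ln ((H *v z) $ m + b $ m)))"
    by (intro sum_mono mult_left_mono ln_intensity_ratio_ge x) simp
  also have "\<dots> = ell H y b z - ell H y b x"
    by (simp add: ell_def right_diff_distrib sum_subtractf)
  finally show ?thesis by simp
qed

section \<open>The majorants and their order\<close>

text \<open>The linear terms \<open>a6 H y b z n * (x $ n / z $ n - 1)\<close> occur with opposite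
  signs in the gradient term and in the Bregman distance, so the majorant condition becomes exactly
  \<open>ell_le\<close>.\<close>

lemma bregman_tangent_h6:
  assumes x: "x \<in> pos_orthant"
  shows "bregman_tangent (ell H y b) (h6 H y b z) z x =
    ell H y b z - (\<Sum>n\<in>UNIV. a6 H y b z n * ln (x $ n / z $ n))"
proof -
  have zpos: "0 < z $ n" for n using z by (simp add: pos_orthant_def)
  have "inner (gradient (ell H y b) z) (x - z) =
      (\<Sum>n\<in>UNIV. - (a6 H y b z n * (x $ n / z $ n - 1)))"
    unfolding inner_vec_def
  proof (rule sum.cong[OF refl])
    fix n
    show "inner (gradient (ell H y b) z $ n) ((x - z) $ n) = - (a6 H y b z n * (x $ n / z $ n - 1))"
      using zpos[of n] by (simp add: gradient_ell_eq_a6 field_simps)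
  qed
  moreover have "bregman_dist (h6 H y b z) x z =
      (\<Sum>n\<in>UNIV. a6 H y b z n * (x $ n / z $ n - 1 - ln (x $ n / z $ n)))"
    using x z by (simp add: h6_eq bregman_dist_log_barrier pos_orthant_def)
  ultimately show ?thesis
    by (simp add: bregman_tangent_def sum_negf right_diff_distrib sum_subtractf)
qed

lemma majorant_h6: "bregman_tangent_majorant pos_orthant (ell H y b) (h6 H y b z) z"
proof -
  have "ell H y b differentiable (at x)" if "x \<in> pos_orthant" for x
    using GDERIV_ell[OF that] unfolding gderiv_def differentiable_def by blast
  moreover have "open (pos_orthant :: (real^'n) set)"
    using open_orthant[of 0] by (simp add: pos_orthant_def)
  moreover have "pos_orthant \<subseteq> edom (h6 H y b z)"
    by (simp add: h6_eq edom_log_barrier pos_orthant_def)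
  ultimately show ?thesis
    using z ell_le legendre_log_barrier[of "a6 H y b z" 0, OF a6_pos, folded h6_eq]
    by (simp add: bregman_tangent_majorant_def bregman_tangent_h6)
qed

lemma h6_bregman_le_h5: "h6 H y b z \<preceq>\<^sub>B h5 H y b z"
  unfolding h5_eq h6_eq by (rule bregman_le_log_barrier_weights[OF a6_pos a6_le_a1])

lemma h1_bregman_le_h5: "h1 H y b z \<preceq>\<^sub>B h5 H y b z"
  unfolding h1_eq h5_eq using rho_pos by (intro bregman_le_log_barrier_shift a1_pos) simp

lemma majorant_h5: "bregman_tangent_majorant pos_orthant (ell H y b) (h5 H y b z) z"
  using majorant_h6 h6_bregman_le_h5
  by (rule bregman_tangent_majorant_mono) (simp add: h5_eq edom_log_barrier pos_orthant_def)

end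

theorem proposition5p3:
  fixes H :: "real^'n^'m" and y :: "nat^'m" and b :: "real^'m" and z :: "real^'n"
  assumes H_nonneg: "\<And>m n. 0 \<le> H $ m $ n"
    and b_pos: "\<And>m. 0 < b $ m"
    and row_sums: "\<And>m. 0 < (\<Sum>n\<in>UNIV. H $ m $ n)"
    and HTy_pos: "\<And>n. 0 < (transpose H *v (\<chi> m. real (y $ m))) $ n"
    and z: "z \<in> pos_orthant"
  shows "legendre (h5 H y b z) \<and>
         bregman_tangent_majorant pos_orthant (ell H y b) (h5 H y b z) z \<and>
         legendre (h6 H y b z) \<and>
         bregman_tangent_majorant pos_orthant (ell H y b) (h6 H y b z) z \<and>
         h1 H y b z \<preceq>\<^sub>B h5 H y b z \<and>
         h6 H y b z \<preceq>\<^sub>B h5 H y b z"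
proof -
  interpret poisson_model H y b z
    by unfold_locales (fact H_nonneg b_pos row_sums HTy_pos z)+
  \<comment> \<open>Both Legendre claims are read off from the order relation, whose definition
    includes them.\<close>
  show ?thesis
    using majorant_h5 majorant_h6 h1_bregman_le_h5 h6_bregman_le_h5
    by (simp add: bregman_le_def)
qed

end
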